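(* Let $\mathbf p=(p_1,\dots,p_r)$ and $\mathbf q=(q_1,\dots,q_r)$ be probability distributions on $\mathcal X=\{c_1,\dots,c_r\}$ with $p_j>0$ and $q_j>0$ for all $j\in D$, and let $\alpha>0$, $\alpha\ne1$. Let $\widehat{\mathbf p}_n$ and $\widehat{\mathbf q}_m$ be the empirical distributions of i.i.d. samples $X_1,\dots,X_n$ from $\mathbf p$ and $Y_1,\dots,Y_m$ from $\mathbf q$. Then: (a) (One sample) $$\limsup_{n\to+\infty}\frac{|\mathcal D_{T,\alpha}(\widehat{\mathbf p}_n,\mathbf q)-\mathcal D_{T,\alpha}(\mathbf p,\mathbf q)|}{a_n}\le A_{T,\alpha,1}\quad\text{a.s.},\qquad\limsup_{n\to+\infty}\frac{|\mathcal D_{T,\alpha}(\mathbf p,\widehat{\mathbf q}_n)-\mathcal D_{T,\alpha}(\mathbf p,\mathbf q)|}{b_n}\le A_{T,\alpha,2}\quad\text{a.s.}$$ (b) (Two samples) $$\limsup_{(n,m)\to(+\infty,+\infty)}\frac{|\mathcal D_{T,\alpha}(\widehat{\mathbf p}_n,\widehat{\mathbf q}_m)-\mathcal D_{T,\alpha}(\mathbf p,\mathbf q)|}{c_{n,m}}\le A_{T,\alpha,1}+A_{T,\alpha,2}\quad\text{a.s.}$$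
   Context: $\mathcal X=\{c_1,\dots,c_r\}$ with $r\ge 2$ is a finite set of distinct points and $D=\{1,\dots,r\}$. A probability distribution $\mathbf p$ on $\mathcal X$ is identified with the vector $(p_1,\dots,p_r)$, $p_j$ being the mass of $c_j$. $X_1,X_2,\dots$ are i.i.d. with $\mathbb P(X_i=c_j)=p_j$, and $Y_1,Y_2,\dots$ are i.i.d. with $\mathbb P(Y_i=c_j)=q_j$; the two sequences are independent of each other. Empirical probabilities: $\widehat p_n^{c_j}=\frac1n\sum_{i=1}^n 1_{\{X_i=c_j\}}$, $\widehat q_m^{c_j}=\frac1m\sum_{i=1}^m 1_{\{Y_i=c_j\}}$, $\widehat{\mathbf p}_n=(\widehat p_n^{c_j})_{j\in D}$, $\widehat{\mathbf q}_m=(\widehat q_m^{c_j})_{j\in D}$. $a_n=\sup_{j\in D}|\widehat p_n^{c_j}-p_j|$, $b_m=\sup_{j\in D}|\widehat q_m^{c_j}-q_j|$, $c_{n,m}=\max(a_n,b_m)$. Tsallis-$\alpha$ divergence: $\mathcal D_{T,\alpha}(\mathbf p,\mathbf q)=\frac1{\alpha-1}\Bigl(\sum_{j\in D}p_j^\alpha q_j^{1-\alpha}-1\Bigr)$. $$A_{T,\alpha,1}=\frac{\alpha}{|\alpha-1|}\sum_{j\in D}(p_j/q_j)^{\alpha-1},\qquad A_{T,\alpha,2}=\sum_{j\in D}(p_j/q_j)^{\alpha}.$$ Conventions: a ratio $0/0$ is read as $0$; if an empirical divergence is undefined because some empirical probability vanishes, it is given the value $0$; $\limsup_{(n,m)\to(+\infty,+\infty)}x_{n,m}=\lim_{N\to\infty}\sup_{n,m\ge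 N}x_{n,m}$. *)

theory Defs
  imports "HOL-Probability.Probability"
begin

definition empirical :: "(nat \<Rightarrow> 'a) \<Rightarrow> (nat \<Rightarrow> 'w \<Rightarrow> 'a) \<Rightarrow> nat \<Rightarrow> 'w \<Rightarrow> nat \<Rightarrow> real" where
  "empirical c X n \<omega> j = (1 / real n) * (\<Sum>i=1..n. of_bool (X i \<omega> = c j))"

definition sup_dev :: "nat \<Rightarrow> (nat \<Rightarrow> real) \<Rightarrow> (nat \<Rightarrow> real) \<Rightarrow> real" where
  "sup_dev r u v = (SUP j\<in>{1..r}. \<bar>u j - v j\<bar>)"

(* For nonnegative u, v and \<alpha> > 0, \<alpha> \<noteq> 1, the sum is undefined exactly when \<alpha> > 1 and some v j
   is 0 (a negative power of 0); the value is then 0 by convention. For 0 < \<alpha> < 1 both exponents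
   are positive, so 0 powr _ = 0 is the usual value. *)
definition tsallis_div :: "nat \<Rightarrow> real \<Rightarrow> (nat \<Rightarrow> real) \<Rightarrow> (nat \<Rightarrow> real) \<Rightarrow> real" where
  "tsallis_div r \<alpha> u v =
     (if \<alpha> > 1 \<and> (\<exists>j\<in>{1..r}. v j = 0) then 0
      else (1 / (\<alpha> - 1)) * ((\<Sum>j=1..r. u j powr \<alpha> * v j powr (1 - \<alpha>)) - 1))"

definition A_T1 :: "nat \<Rightarrow> real \<Rightarrow> (nat \<Rightarrow> real) \<Rightarrow> (nat \<Rightarrow> real) \<Rightarrow> real" where
  "A_T1 r \<alpha> p q = (\<alpha> / \<bar>\<alpha> - 1\<bar>) * (\<Sum>j=1..r. (p j / q j) powr (\<alpha> - 1))"

definition A_T2 :: "nat \<Rightarrow> real \<Rightarrow> (nat \<Rightarrow> real) \<Rightarrow> (nat \<Rightarrow> real) \<Rightarrow> real" where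
  "A_T2 r \<alpha> p q = (\<Sum>j=1..r. (p j / q j) powr \<alpha>)"

definition limsup2 :: "(nat \<Rightarrow> nat \<Rightarrow> ereal) \<Rightarrow> ereal" where
  "limsup2 x = lim (\<lambda>N. SUP (n, m)\<in>{N..} \<times> {N..}. x n m)"

lemma limsup2_eq_INF: "limsup2 x = (INF N. SUP (n, m)\<in>{N..} \<times> {N..}. x n m)"
proof -
  have "decseq (\<lambda>N. SUP (n, m)\<in>{N..} \<times> {N..}. x n m)"
    by (intro antimonoI SUP_subset_mono) auto
  then show ?thesis
    unfolding limsup2_def by (intro limI LIMSEQ_INF)
qed

lemma limsup2_eq_Limsup:
  "limsup2 x = Limsup (sequentially \<times>\<^sub>F sequentially) (\<lambda>(n, m). x n m)"
proof (rule antisym)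
  show "limsup2 x \<le> Limsup (sequentially \<times>\<^sub>F sequentially) (\<lambda>(n, m). x n m)"
    unfolding Limsup_def
  proof (rule INF_greatest)
    fix P assume "P \<in> {P. eventually P (sequentially \<times>\<^sub>F sequentially)}"
    then obtain N where N: "\<And>n m. n \<ge> N \<Longrightarrow> m \<ge> N \<Longrightarrow> P (n, m)"
      by (auto simp: eventually_prod_sequentially)
    have "limsup2 x \<le> (SUP (n, m)\<in>{N..} \<times> {N..}. x n m)"
      unfolding limsup2_eq_INF by (rule INF_lower) simp
    also have "\<dots> \<le> (SUP (n, m)\<in>Collect P. x n m)"
      using N by (intro SUP_subset_mono) auto
    finally show "limsup2 x \<le> (SUP (n, m)\<in>Collect P. x n m)" .
  qed
  show "Limsup (sequentially \<times>\<^sub>F sequentially) (\<lambda>(n, m). x n m) \<le> limsup2 x"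
    unfolding limsup2_eq_INF
  proof (rule INF_greatest)
    fix N :: nat
    have "eventually (\<lambda>nm. nm \<in> {N..} \<times> {N..}) (sequentially \<times>\<^sub>F sequentially)"
      by (auto simp: eventually_prod_sequentially)
    then have "Limsup (sequentially \<times>\<^sub>F sequentially) (\<lambda>(n, m). x n m)
        \<le> (SUP (n, m)\<in>Collect (\<lambda>nm. nm \<in> {N..} \<times> {N..}). x n m)"
      unfolding Limsup_def by (intro INF_lower) simp
    then show "Limsup (sequentially \<times>\<^sub>F sequentially) (\<lambda>(n, m). x n m)
        \<le> (SUP (n, m)\<in>{N..} \<times> {N..}. x n m)"
      by (simp only: Collect_mem_eq)
  qed
qed

end

theory Submission
  imports Defs
begin

text \<open>
  By Hoeffding's inequality and the Borel--Cantelli lemma the empirical frequencies converge almost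
  surely, so everything reduces to a first-order expansion of the divergence at \<open>(p, q)\<close>, where it is
  differentiable with partial derivatives \<open>\<alpha> / (\<alpha> - 1) (p\<^sub>j / q\<^sub>j)\<^sup>\<alpha>\<^sup>-\<^sup>1\<close> in the first and
  \<open>- (p\<^sub>j / q\<^sub>j)\<^sup>\<alpha>\<close> in the second argument. The sums of their absolute values are the two constants.
\<close>

section \<open>Almost sure convergence of the empirical frequencies\<close>

text \<open>For bounded independent variables Hoeffding's inequality makes the probability of a
  fixed deviation of the mean decay geometrically in \<open>n\<close>. These probabilities are
  summable, so by Borel-Cantelli almost surely only finitely many deviations occur.\<close>

lemma (in prob_space) bounded_strong_law:
  fixes Z :: "nat \<Rightarrow> 'a \<Rightarrow> real"
  assumes indep: "indep_vars (\<lambda>_. borel) Z {1..}"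
    and bnd: "\<And>i. i \<ge> 1 \<Longrightarrow> AE \<omega> in M. Z i \<omega> \<in> {a..b}"
    and "a < b"
    and mean: "\<And>i. i \<ge> 1 \<Longrightarrow> expectation (Z i) = \<mu>"
  shows "AE \<omega> in M. (\<lambda>n. (1 / real n) * (\<Sum>i=1..n. Z i \<omega>)) \<longlonglongrightarrow> \<mu>"
proof -
  have meas: "Z i \<in> borel_measurable M" if "i \<ge> 1" for i
    using indep that by (auto simp: indep_vars_def)
  have S_meas [measurable]: "(\<lambda>\<omega>. \<Sum>i=1..n. Z i \<omega>) \<in> borel_measurable M" for n
    using meas by (intro borel_measurable_sum) auto
  have dev: "AE \<omega> in M. \<forall>\<^sub>F n in sequentially. \<bar>(\<Sum>i=1..n. Z i \<omega>) - real n * \<mu>\<bar> < real n * \<epsilon>"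
    if "\<epsilon> > 0" for \<epsilon> :: real
  proof -
    define A where "A = (\<lambda>n. {\<omega> \<in> space M. \<bar>(\<Sum>i=1..n. Z i \<omega>) - real n * \<mu>\<bar> \<ge> real n * \<epsilon>})"
    define \<rho> where "\<rho> = exp (- 2 * \<epsilon>\<^sup>2 / (b - a)\<^sup>2)"
    have "\<rho> < 1"
      using \<open>\<epsilon> > 0\<close> \<open>a < b\<close> by (simp add: \<rho>_def field_simps)
    have A_bound: "prob (A n) \<le> 2 * \<rho> ^ n" for n
    \<comment> \<open>For \<open>n = 0\<close> the Hoeffding exponent has denominator 0. The factor
      2 makes the bound trivial there, since a probability is at most 1.\<close>
    proof (cases "n = 0")
      case True
      then show ?thesis
        by (intro order_trans[OF prob_le_1]) simp
    next
      case False
      interpret H: Hoeffding_ineq M "{1..n}" Z "\<lambda>_. a" "\<lambda>_. b" "\<Sum>i=1..n. expectation (Z i)"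
        using indep_vars_subset[OF indep, of "{1..n}"] bnd by unfold_locales auto
      have "(\<Sum>i=1..n. expectation (Z i)) = real n * \<mu>"
        using mean by simp
      then have "prob (A n) \<le> 2 * exp (- 2 * (real n * \<epsilon>)\<^sup>2 / (\<Sum>i=1..n. (b - a)\<^sup>2))"
        using H.Hoeffding_ineq_abs_ge[of "real n * \<epsilon>"] \<open>\<epsilon> > 0\<close> \<open>a < b\<close> False by (simp add: A_def)
      \<comment> \<open>The squared deviation contributes \<open>n\<close> twice and the sum of
        squared ranges cancels one of them, so the exponent is linear in \<open>n\<close> and the
        bound geometric.\<close>
      also have "- 2 * (real n * \<epsilon>)\<^sup>2 / (\<Sum>i=1..n. (b - a)\<^sup>2) = real n * (- 2 * \<epsilon>\<^sup>2 / (b - a)\<^sup>2)"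
        using False by (simp add: power_mult_distrib power2_eq_square[of "real n"])
      also have "exp \<dots> = \<rho> ^ n"
        unfolding \<rho>_def by (rule exp_of_nat_mult)
      finally show ?thesis .
    qed
    have "summable (\<lambda>n. 2 * \<rho> ^ n)"
      using \<open>\<rho> < 1\<close> by (intro summable_mult summable_geometric) (simp add: \<rho>_def)
    then have "summable (\<lambda>n. prob (A n))"
      by (rule summable_comparison_test'[where N = 0]) (simp add: A_bound)
    moreover have "A n \<in> events" for n
      unfolding A_def by measurable
    ultimately have "AE \<omega> in M. \<forall>\<^sub>F n in sequentially. \<omega> \<in> space M - A n"
      by (intro borel_cantelli_AE1) (simp_all add: less_top[symmetric])
    then show ?thesis
      by eventually_elim (auto simp: A_def not_le elim: eventually_mono)
  qed
  \<comment> \<open>The null set in \<open>dev\<close> depends on \<epsilon>. Restricting to the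
    countably many values \<open>1 / Suc k\<close> yields one null set for all of them.\<close>
  have "AE \<omega> in M. \<forall>k. \<forall>\<^sub>F n in sequentially.
      \<bar>(\<Sum>i=1..n. Z i \<omega>) - real n * \<mu>\<bar> < real n * (1 / real (Suc k))"
    unfolding AE_all_countable by (intro allI dev) simp
  then show ?thesis
  proof eventually_elim
    case (elim \<omega>)
    show ?case
    proof (rule tendstoI)
      fix e :: real assume "e > 0"
      then obtain k where k: "1 / real (Suc k) < e"
        using nat_approx_posE by blast
      from elim[rule_format, of k] eventually_gt_at_top[of 0]
      show "\<forall>\<^sub>F n in sequentially. dist ((1 / real n) * (\<Sum>i=1..n. Z i \<omega>)) \<mu> < e"
      proof eventually_elim
        case (elim n)
        have "dist ((1 / real n) * (\<Sum>i=1..n. Z i \<omega>)) \<mu>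
            = \<bar>((\<Sum>i=1..n. Z i \<omega>) - real n * \<mu>) / real n\<bar>"
          using elim by (simp add: dist_real_def diff_divide_distrib)
        also have "\<dots> < 1 / real (Suc k)"
          using elim by (simp add: abs_divide pos_divide_less_eq mult.commute)
        finally show ?case
          using k by simp
      qed
    qed
  qed
qed

text \<open>The strong law applies to the indicators of \<open>X i = c j\<close>, which lie in
  [0, 1] and have mean \<open>p j\<close>. Only finitely many \<open>j\<close> occur, so their null
  sets can be united.\<close>

lemma (in prob_space) empirical_tendsto:
  fixes X :: "nat \<Rightarrow> 'a \<Rightarrow> 'b"
  assumes indep: "indep_vars (\<lambda>_. count_space (c ` {1..r})) X {1..}"
    and prob: "\<forall>i\<ge>1. \<forall>j\<in>{1..r}. \<P>(\<omega> in M. X i \<omega> = c j) = p j"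
  shows "AE \<omega> in M. \<forall>j\<in>{1..r}. (\<lambda>n. empirical c X n \<omega> j) \<longlonglongrightarrow> p j"
proof -
  have "AE \<omega> in M. (\<lambda>n. empirical c X n \<omega> j) \<longlonglongrightarrow> p j" if j: "j \<in> {1..r}" for j
    unfolding empirical_def
  proof (rule bounded_strong_law[where a = 0 and b = 1])
    show "indep_vars (\<lambda>_. borel) (\<lambda>i \<omega>. of_bool (X i \<omega> = c j) :: real) {1..}"
      by (rule indep_vars_compose2[OF indep, where Y = "\<lambda>_ x. of_bool (x = c j)"]) simp
  next
    fix i :: nat assume i: "i \<ge> 1"
    have X_meas: "X i \<in> M \<rightarrow>\<^sub>M count_space (c ` {1..r})"
      using indep i by (auto simp: indep_vars_def)
    have "{\<omega> \<in> space M. X i \<omega> = c j} = X i -` {c j} \<inter> space M"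
      by auto
    also have "\<dots> \<in> events"
      using j by (intro measurable_sets[OF X_meas]) auto
    finally have ev: "{\<omega> \<in> space M. X i \<omega> = c j} \<in> events" .
    have "expectation (\<lambda>\<omega>. of_bool (X i \<omega> = c j)) =
        expectation (indicator {\<omega> \<in> space M. X i \<omega> = c j} :: _ \<Rightarrow> real)"
      by (intro Bochner_Integration.integral_cong) (auto simp: indicator_def)
    also have "\<dots> = p j"
      using prob i j ev by simp
    finally show "expectation (\<lambda>\<omega>. of_bool (X i \<omega> = c j)) = p j" .
  qed auto
  then show ?thesis
    by (simp add: AE_finite_all)
qed

section \<open>First-order expansion of the divergence\<close>

text \<open>The summand is differentiable at a point with positive coordinates, and the remainder is
  absorbed into \<epsilon>. The filter is arbitrary so that the result serves both single sequences
  and pairs of sample sizes.\<close>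

lemma powr_mult_powr_first_order:
  fixes x y :: real
  assumes "x > 0" "y > 0" "\<epsilon> > 0"
    and u: "(u \<longlongrightarrow> x) F" and v: "(v \<longlongrightarrow> y) F"
  shows "\<forall>\<^sub>F i in F. \<bar>u i powr \<alpha> * v i powr (1 - \<alpha>) - x powr \<alpha> * y powr (1 - \<alpha>)\<bar>
    \<le> (\<bar>\<alpha>\<bar> * (x / y) powr (\<alpha> - 1) + \<epsilon>) * \<bar>u i - x\<bar> + (\<bar>\<alpha> - 1\<bar> * (x / y) powr \<alpha> + \<epsilon>) * \<bar>v i - y\<bar>"
proof -
  define f where "f = (\<lambda>z :: real \<times> real. fst z powr \<alpha> * snd z powr (1 - \<alpha>))"
  define d1 where "d1 = \<alpha> * (x / y) powr (\<alpha> - 1)"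
  define d2 where "d2 = (1 - \<alpha>) * (x / y) powr \<alpha>"
  \<comment> \<open>The derivative rule for \<open>powr\<close> produces logarithmic derivatives,
    that is, the value of the function times an exponent over a coordinate. \<open>d1_eq\<close> and
    \<open>d2_eq\<close> bring the coefficients to this shape.\<close>
  have d1_eq: "d1 = \<alpha> * x powr \<alpha> * y powr (1 - \<alpha>) / x"
    using assms by (simp add: d1_def powr_divide powr_diff field_simps)
  have d2_eq: "d2 = (1 - \<alpha>) * x powr \<alpha> * y powr (1 - \<alpha>) / y"
    using assms by (simp add: d2_def powr_divide powr_diff field_simps)
  have "(f has_derivative (\<lambda>h. d1 * fst h + d2 * snd h)) (at (x, y))"
    unfolding f_def using assms(1,2)
    by (auto intro!: derivative_eq_intros simp: d1_eq d2_eq algebra_simps fun_eq_iff)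
  then obtain d where "d > 0" and d: "\<And>z. norm (z - (x, y)) < d \<Longrightarrow>
      \<bar>f z - f (x, y) - (d1 * fst (z - (x, y)) + d2 * snd (z - (x, y)))\<bar> \<le> \<epsilon> * norm (z - (x, y))"
    using \<open>\<epsilon> > 0\<close> unfolding has_derivative_at_alt real_norm_def by meson
  have "((\<lambda>i. (u i, v i)) \<longlongrightarrow> (x, y)) F"
    by (intro tendsto_Pair u v)
  from tendstoD[OF this \<open>d > 0\<close>] have "\<forall>\<^sub>F i in F. norm ((u i, v i) - (x, y)) < d"
    unfolding dist_norm .
  then show ?thesis
  proof eventually_elim
    case (elim i)
    define h where "h = u i - x"
    define k where "k = v i - y"
    have "\<bar>f (u i, v i) - f (x, y) - (d1 * h + d2 * k)\<bar> \<le> \<epsilon> * norm (h, k)"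
      using d[OF elim] by (simp add: h_def k_def)
    also have "\<dots> \<le> \<epsilon> * (\<bar>h\<bar> + \<bar>k\<bar>)"
      using \<open>\<epsilon> > 0\<close> norm_Pair_le[of h k] by (intro mult_left_mono) auto
    finally have "\<bar>f (u i, v i) - f (x, y)\<bar> \<le> \<bar>d1 * h\<bar> + \<bar>d2 * k\<bar> + \<epsilon> * (\<bar>h\<bar> + \<bar>k\<bar>)"
      by linarith
    also have "\<dots> = (\<bar>d1\<bar> + \<epsilon>) * \<bar>h\<bar> + (\<bar>d2\<bar> + \<epsilon>) * \<bar>k\<bar>"
      by (simp add: abs_mult algebra_simps)
    finally show ?case
      by (simp add: f_def d1_def d2_def h_def k_def abs_mult abs_minus_commute)
  qed
qed

lemma abs_le_sup_dev:
  assumes "j \<in> {1..r}"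
  shows "\<bar>u j - v j\<bar> \<le> sup_dev r u v"
  unfolding sup_dev_def using assms by (intro cSUP_upper) auto

lemma sup_dev_nonneg:
  assumes "r \<ge> 1"
  shows "0 \<le> sup_dev r u v"
  using abs_le_sup_dev[of 1 r u v] assms by simp

lemma sup_dev_same:
  assumes "r \<ge> 1"
  shows "sup_dev r u u = 0"
  unfolding sup_dev_def using assms by simp

text \<open>Bounding each coordinate deviation by the supremum leaves the sums of the absolute
  partial derivatives as coefficients. Dividing by the absolute value of \<open>\<alpha> - 1\<close>
  turns these sums into \<open>A_T1\<close> and \<open>A_T2\<close>.\<close>

lemma tsallis_div_first_order:
  assumes "r \<ge> 1"
    and p: "\<forall>j\<in>{1..r}. p j > 0" and q: "\<forall>j\<in>{1..r}. q j > 0"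
    and \<alpha>: "\<alpha> > 0" "\<alpha> \<noteq> 1" and "\<epsilon> > 0"
    and u: "\<forall>j\<in>{1..r}. ((\<lambda>i. u i j) \<longlongrightarrow> p j) F"
    and v: "\<forall>j\<in>{1..r}. ((\<lambda>i. v i j) \<longlongrightarrow> q j) F"
  shows "\<forall>\<^sub>F i in F. \<bar>tsallis_div r \<alpha> (u i) (v i) - tsallis_div r \<alpha> p q\<bar>
    \<le> (A_T1 r \<alpha> p q + \<epsilon>) * sup_dev r (u i) p + (A_T2 r \<alpha> p q + \<epsilon>) * sup_dev r (v i) q"
proof -
  define \<beta> where "\<beta> = \<bar>\<alpha> - 1\<bar>"
  have "\<beta> > 0"
    using \<alpha> by (simp add: \<beta>_def)
  \<comment> \<open>Chosen so that the errors of the \<open>r\<close> coordinates add up to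
    \<open>\<beta> * \<epsilon>\<close>, which becomes \<epsilon> after the division by
    \<beta>.\<close>
  define \<delta> where "\<delta> = \<beta> * \<epsilon> / real r"
  have "\<delta> > 0"
    using \<open>\<epsilon> > 0\<close> \<open>\<beta> > 0\<close> \<open>r \<ge> 1\<close> by (simp add: \<delta>_def)
  define g where "g = (\<lambda>s t :: nat \<Rightarrow> real. \<lambda>j. s j powr \<alpha> * t j powr (1 - \<alpha>))"
  define D1 where "D1 = (\<lambda>j. \<bar>\<alpha>\<bar> * (p j / q j) powr (\<alpha> - 1))"
  define D2 where "D2 = (\<lambda>j. \<bar>\<alpha> - 1\<bar> * (p j / q j) powr \<alpha>)"
  have "\<forall>\<^sub>F i in F. \<forall>j\<in>{1..r}. \<bar>g (u i) (v i) j - g p q j\<bar>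
      \<le> (D1 j + \<delta>) * \<bar>u i j - p j\<bar> + (D2 j + \<delta>) * \<bar>v i j - q j\<bar>"
    unfolding g_def D1_def D2_def using p q u v \<open>\<delta> > 0\<close>
    by (intro eventually_ball_finite ballI powr_mult_powr_first_order) auto
  \<comment> \<open>Eventual positivity rules out the branch of \<open>tsallis_div\<close> with the
    default value 0.\<close>
  moreover have "\<forall>\<^sub>F i in F. \<forall>j\<in>{1..r}. v i j > 0"
    using q v by (intro eventually_ball_finite) (auto intro: order_tendstoD)
  ultimately show ?thesis
  proof eventually_elim
    case (elim i)
    define a where "a = sup_dev r (u i) p"
    define b where "b = sup_dev r (v i) q"
    have "\<bar>g (u i) (v i) j - g p q j\<bar> \<le> (D1 j + \<delta>) * a + (D2 j + \<delta>) * b" if "j \<in> {1..r}" for j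
    proof -
      have "\<bar>g (u i) (v i) j - g p q j\<bar> \<le> (D1 j + \<delta>) * \<bar>u i j - p j\<bar> + (D2 j + \<delta>) * \<bar>v i j - q j\<bar>"
        using elim that by blast
      also have "\<dots> \<le> (D1 j + \<delta>) * a + (D2 j + \<delta>) * b"
        using that \<open>\<delta> > 0\<close> unfolding a_def b_def
        by (intro add_mono mult_left_mono abs_le_sup_dev) (auto simp: D1_def D2_def)
      finally show ?thesis .
    qed
    then have "\<bar>\<Sum>j=1..r. g (u i) (v i) j - g p q j\<bar> \<le> (\<Sum>j=1..r. (D1 j + \<delta>) * a + (D2 j + \<delta>) * b)"
      by (intro order_trans[OF sum_abs] sum_mono)
    also have "\<dots> = ((\<Sum>j=1..r. D1 j) + real r * \<delta>) * a + ((\<Sum>j=1..r. D2 j) + real r * \<delta>) * b"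
      by (simp add: sum.distrib sum_distrib_right distrib_right)
    also have "(\<Sum>j=1..r. D1 j) = \<beta> * A_T1 r \<alpha> p q"
      using \<alpha> by (simp add: D1_def A_T1_def \<beta>_def sum_distrib_left)
    also have "(\<Sum>j=1..r. D2 j) = \<beta> * A_T2 r \<alpha> p q"
      by (simp add: D2_def A_T2_def \<beta>_def sum_distrib_left)
    also have "real r * \<delta> = \<beta> * \<epsilon>"
      using \<open>r \<ge> 1\<close> by (simp add: \<delta>_def)
    finally have "\<bar>\<Sum>j=1..r. g (u i) (v i) j - g p q j\<bar>
        \<le> \<beta> * ((A_T1 r \<alpha> p q + \<epsilon>) * a + (A_T2 r \<alpha> p q + \<epsilon>) * b)"
      by (simp add: algebra_simps)
    moreover have "tsallis_div r \<alpha> (u i) (v i) - tsallis_div r \<alpha> p q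
        = (\<Sum>j=1..r. g (u i) (v i) j - g p q j) / (\<alpha> - 1)"
    proof -
      have "\<not> (\<exists>j\<in>{1..r}. v i j = 0)" "\<not> (\<exists>j\<in>{1..r}. q j = 0)"
        using elim q by force+
      then show ?thesis
        by (simp add: tsallis_div_def g_def sum_subtractf diff_divide_distrib)
    qed
    ultimately show ?case
      using \<open>\<beta> > 0\<close> by (simp add: \<beta>_def a_def b_def abs_divide pos_divide_le_eq mult.commute)
  qed
qed

section \<open>From the expansion to the limsup bounds\<close>

text \<open>The hypothesis is a product bound, so it remains meaningful where
  \<open>d i = 0\<close>. There the quotient has the value 0 by the convention for division, and
  \<open>C \<ge> 0\<close> keeps the bound valid.\<close>

lemma Limsup_ratio_le:
  fixes f d :: "'i \<Rightarrow> real"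
  assumes "C \<ge> 0" and "\<And>i. d i \<ge> 0"
    and ev: "\<And>\<epsilon>. \<epsilon> > 0 \<Longrightarrow> \<forall>\<^sub>F i in F. f i \<le> (C + \<epsilon>) * d i"
  shows "Limsup F (\<lambda>i. ereal (f i / d i)) \<le> ereal C"
proof (rule ereal_le_epsilon2)
  fix \<epsilon> :: real assume "\<epsilon> > 0"
  have "\<forall>\<^sub>F i in F. ereal (f i / d i) \<le> ereal (C + \<epsilon>)"
    using ev[OF \<open>\<epsilon> > 0\<close>]
  proof eventually_elim
    case (elim i)
    then show ?case
      using assms(1) assms(2)[of i] \<open>\<epsilon> > 0\<close> by (cases "d i = 0") (auto simp: pos_divide_le_eq)
  qed
  then show "Limsup F (\<lambda>i. ereal (f i / d i)) \<le> ereal C + ereal \<epsilon>"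
    by (intro Limsup_bounded) simp
qed

theorem corollary1:
  fixes r :: nat and c :: "nat \<Rightarrow> 'a" and p q :: "nat \<Rightarrow> real" and \<alpha> :: real
    and M :: "'w measure" and X Y :: "nat \<Rightarrow> 'w \<Rightarrow> 'a"
  assumes "r \<ge> 2" and "inj_on c {1..r}"
    and "\<forall>j\<in>{1..r}. p j > 0" and "(\<Sum>j=1..r. p j) = 1"
    and "\<forall>j\<in>{1..r}. q j > 0" and "(\<Sum>j=1..r. q j) = 1"
    and "\<alpha> > 0" and "\<alpha> \<noteq> 1"
    and "prob_space M"
    and "prob_space.indep_vars M (\<lambda>_. count_space (c ` {1..r})) X {1..}"
    and "\<forall>i\<ge>1. \<forall>j\<in>{1..r}. \<P>(\<omega> in M. X i \<omega> = c j) = p j"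
    and "prob_space.indep_vars M (\<lambda>_. count_space (c ` {1..r})) Y {1..}"
    and "\<forall>i\<ge>1. \<forall>j\<in>{1..r}. \<P>(\<omega> in M. Y i \<omega> = c j) = q j"
    and "prob_space.indep_var M
           (PiM {1..} (\<lambda>_. count_space (c ` {1..r}))) (\<lambda>\<omega>. \<lambda>i\<in>{1..}. X i \<omega>)
           (PiM {1..} (\<lambda>_. count_space (c ` {1..r}))) (\<lambda>\<omega>. \<lambda>i\<in>{1..}. Y i \<omega>)"
  shows "(AE \<omega> in M. limsup (\<lambda>n. ereal
           (\<bar>tsallis_div r \<alpha> (empirical c X n \<omega>) q - tsallis_div r \<alpha> p q\<bar>
            / sup_dev r (empirical c X n \<omega>) p))
         \<le> ereal (A_T1 r \<alpha> p q))
       \<and> (AE \<omega> in M. limsup (\<lambda>n. ereal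
           (\<bar>tsallis_div r \<alpha> p (empirical c Y n \<omega>) - tsallis_div r \<alpha> p q\<bar>
            / sup_dev r (empirical c Y n \<omega>) q))
         \<le> ereal (A_T2 r \<alpha> p q))
       \<and> (AE \<omega> in M. limsup2 (\<lambda>n m. ereal
           (\<bar>tsallis_div r \<alpha> (empirical c X n \<omega>) (empirical c Y m \<omega>) - tsallis_div r \<alpha> p q\<bar>
            / max (sup_dev r (empirical c X n \<omega>) p) (sup_dev r (empirical c Y m \<omega>) q)))
         \<le> ereal (A_T1 r \<alpha> p q + A_T2 r \<alpha> p q))"
proof -
  interpret prob_space M by fact
  have "r \<ge> 1"
    using \<open>r \<ge> 2\<close> by simp
  note first_order = tsallis_div_first_order[OF \<open>r \<ge> 1\<close> assms(3,5,7,8)]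
  have A1: "A_T1 r \<alpha> p q \<ge> 0"
    using \<open>\<alpha> > 0\<close> by (simp add: A_T1_def sum_nonneg)
  have A2: "A_T2 r \<alpha> p q \<ge> 0"
    by (simp add: A_T2_def sum_nonneg)
  \<comment> \<open>Randomness enters only through \<open>X\<close> and \<open>Y\<close>. The rest
    is deterministic, for a fixed \<omega> at which the frequencies converge.\<close>
  have X: "AE \<omega> in M. \<forall>j\<in>{1..r}. (\<lambda>n. empirical c X n \<omega> j) \<longlonglongrightarrow> p j"
    by (rule empirical_tendsto) fact+
  have Y: "AE \<omega> in M. \<forall>j\<in>{1..r}. (\<lambda>n. empirical c Y n \<omega> j) \<longlonglongrightarrow> q j"
    by (rule empirical_tendsto) fact+
  show ?thesis
  proof (intro conjI)
    show "AE \<omega> in M. limsup (\<lambda>n. ereal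
           (\<bar>tsallis_div r \<alpha> (empirical c X n \<omega>) q - tsallis_div r \<alpha> p q\<bar>
            / sup_dev r (empirical c X n \<omega>) p))
         \<le> ereal (A_T1 r \<alpha> p q)"
      using X
    proof eventually_elim
      case (elim \<omega>)
      show ?case
        \<comment> \<open>With the constant sequence \<open>q\<close> in the second argument, its
          deviation is 0 and only the \<open>A_T1\<close> term survives. The next bound is
          symmetric.\<close>
        using first_order[of _ "\<lambda>n. empirical c X n \<omega>" sequentially "\<lambda>_. q"] elim
        by (intro Limsup_ratio_le A1 sup_dev_nonneg \<open>r \<ge> 1\<close>) (simp add: sup_dev_same[OF \<open>r \<ge> 1\<close>])
    qed
  next
    show "AE \<omega> in M. limsup (\<lambda>n. ereal
           (\<bar>tsallis_div r \<alpha> p (empirical c Y n \<omega>) - tsallis_div r \<alpha> p q\<bar>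
            / sup_dev r (empirical c Y n \<omega>) q))
         \<le> ereal (A_T2 r \<alpha> p q)"
      using Y
    proof eventually_elim
      case (elim \<omega>)
      show ?case
        using first_order[of _ "\<lambda>_. p" sequentially "\<lambda>n. empirical c Y n \<omega>"] elim
        by (intro Limsup_ratio_le A2 sup_dev_nonneg \<open>r \<ge> 1\<close>) (simp add: sup_dev_same[OF \<open>r \<ge> 1\<close>])
    qed
  next
    show "AE \<omega> in M. limsup2 (\<lambda>n m. ereal
           (\<bar>tsallis_div r \<alpha> (empirical c X n \<omega>) (empirical c Y m \<omega>) - tsallis_div r \<alpha> p q\<bar>
            / max (sup_dev r (empirical c X n \<omega>) p) (sup_dev r (empirical c Y m \<omega>) q)))
         \<le> ereal (A_T1 r \<alpha> p q + A_T2 r \<alpha> p q)"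
      using X Y
    proof eventually_elim
      case (elim \<omega>)
      let ?F = "sequentially \<times>\<^sub>F sequentially"
      let ?a = "\<lambda>n. sup_dev r (empirical c X n \<omega>) p"
      let ?b = "\<lambda>m. sup_dev r (empirical c Y m \<omega>) q"
      \<comment> \<open>By \<open>limsup2_eq_Limsup\<close> the double limsup is one along the
        product filter, so each convergence is pulled back along a projection.\<close>
      have u: "\<forall>j\<in>{1..r}. ((\<lambda>nm. empirical c X (fst nm) \<omega> j) \<longlongrightarrow> p j) ?F"
        using elim(1) filterlim_compose[OF _ filterlim_fst] by blast
      have v: "\<forall>j\<in>{1..r}. ((\<lambda>nm. empirical c Y (snd nm) \<omega> j) \<longlongrightarrow> q j) ?F"
        using elim(2) filterlim_compose[OF _ filterlim_snd] by blast
      have "Limsup ?F (\<lambda>nm. ereal (\<bar>tsallis_div r \<alpha> (empirical c X (fst nm) \<omega>)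
            (empirical c Y (snd nm) \<omega>) - tsallis_div r \<alpha> p q\<bar> / max (?a (fst nm)) (?b (snd nm))))
          \<le> ereal (A_T1 r \<alpha> p q + A_T2 r \<alpha> p q)"
      proof (rule Limsup_ratio_le)
        fix \<epsilon> :: real assume "\<epsilon> > 0"
        \<comment> \<open>Each of the two terms gets half of \<epsilon>. Once both deviations are
          replaced by their maximum, the coefficients add up.\<close>
        then have "\<epsilon> / 2 > 0" by simp
        from first_order[OF this u v]
        show "\<forall>\<^sub>F nm in ?F. \<bar>tsallis_div r \<alpha> (empirical c X (fst nm) \<omega>) (empirical c Y (snd nm) \<omega>)
              - tsallis_div r \<alpha> p q\<bar>
            \<le> (A_T1 r \<alpha> p q + A_T2 r \<alpha> p q + \<epsilon>) * max (?a (fst nm)) (?b (snd nm))"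
        proof eventually_elim
          case (elim nm)
          note elim
          also have "(A_T1 r \<alpha> p q + \<epsilon> / 2) * ?a (fst nm) + (A_T2 r \<alpha> p q + \<epsilon> / 2) * ?b (snd nm)
              \<le> (A_T1 r \<alpha> p q + \<epsilon> / 2) * max (?a (fst nm)) (?b (snd nm))
                + (A_T2 r \<alpha> p q + \<epsilon> / 2) * max (?a (fst nm)) (?b (snd nm))"
            using A1 A2 \<open>\<epsilon> > 0\<close> by (intro add_mono mult_left_mono) auto
          finally show ?case
            by (simp add: algebra_simps)
        qed
      qed (use A1 A2 sup_dev_nonneg[OF \<open>r \<ge> 1\<close>] in \<open>auto simp: le_max_iff_disj\<close>)
      then show ?case
        by (simp add: limsup2_eq_Limsup case_prod_unfold)
    qed
  qed
qed

end
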